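(* Each of the following graph operations $\gamma$ preserves well-quasi-orderability by the labelled induced subgraph relation: (i) subgraph complementation; (ii) bipartite complementation; (iii) vertex deletion.
   Context: Graphs are finite, undirected and simple. Operations. Subgraph complementation in a graph $G$: choose a subset $S\subseteq V(G)$ and complement the subgraph of $G$ induced by $S$ (i.e. two distinct vertices of $S$ become adjacent iff they were non-adjacent; all other adjacencies are unchanged). Bipartite complementation in $G$: choose two disjoint subsets $X,Y\subseteq V(G)$ and complement the edges between $X$ and $Y$ (i.e. $x\in X$ and $y\in Y$ become adjacent iff they were non-adjacent; all other adjacencies are unchanged). Vertex deletion in $G$: remove a single vertex together with all edges incident to it. Let $k\geq 0$ be a constant and let $\gamma$ be a graph operation. A graph class $\mathcal{G}'$ is $(k,\gamma)$-obtained from a graph class $\mathcal{G}$ if (a) every graph in $\mathcal{G}'$ is obtained from a graph in $\mathcal{G}$ by performing $\gamma$ at most $k$ times, and (b) for every $G\in\mathcal{G}$ there exists at least one graph in $\mathcal{G}'$ obtained from $G$ by performing $\gamma$ at most $k$ times. The operation $\gamma$ preserves well-quasi-orderability by the labelled induced subgraph relation if for any finite constant $k$ and any graph class $\mathcal{G}$, any graph class $\mathcal{G}'$ that is $(k,\gamma)$-obtained from $\mathcal{G}$ is well-quasi-ordered by this relation if and only if $\mathcal{G}$ is. (Graph classes here need not be closed under induced subgraphs.) A quasi-order is a reflexive, transitive relation. A quasi-order $\leq$ on a set $W$ is a well-quasi-order if every infinite sequence $x_1,x_2,\ldots$ in $W$ contains a pair with $x_i\leq x_j$, $i<j$ (equivalently: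 no infinite strictly decreasing sequence and no infinite antichain, an antichain being a set of pairwise incomparable elements). Given a quasi-order $(W,\leq)$, a labelled graph is a graph $G$ in which each vertex $v$ is assigned a label $l_G(v)\in W$. For labelled graphs $G,H$, $G$ is a labelled induced subgraph of $H$ if there is an isomorphism from $G$ to an induced subgraph of $H$ mapping each vertex $v$ of $G$ to a vertex $w$ of $H$ with $l_G(v)\leq l_H(w)$. A class $X$ of graphs is well-quasi-ordered by the labelled induced subgraph relation if, for every well-quasi-order $(W,\leq)$, there is no infinite antichain (with respect to the labelled induced subgraph relation) of graphs from $X$ labelled with elements of $W$. *)

theory Defs
  imports Complex_Main "HOL-Library.Countable_Set"
begin

section \<open>Finite simple graphs\<close>

record 'v sgraph =
  verts :: "'v set"
  edges :: "'v set set"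

definition simple_graph :: "'v sgraph \<Rightarrow> bool" where
  "simple_graph G \<longleftrightarrow> finite (verts G) \<and> (\<forall>e\<in>edges G. e \<subseteq> verts G \<and> card e = 2)"

definition graph_class :: "'v sgraph set \<Rightarrow> bool" where
  "graph_class X \<longleftrightarrow> (\<forall>G\<in>X. simple_graph G)"

definition induced :: "'v sgraph \<Rightarrow> 'v set \<Rightarrow> 'v sgraph" where
  "induced G U = \<lparr>verts = U, edges = {e \<in> edges G. e \<subseteq> U}\<rparr>"

definition graph_iso :: "('v \<Rightarrow> 'v) \<Rightarrow> 'v sgraph \<Rightarrow> 'v sgraph \<Rightarrow> bool" where
  "graph_iso f G H \<longleftrightarrow>
     bij_betw f (verts G) (verts H) \<and>
     (\<forall>u\<in>verts G. \<forall>v\<in>verts G. {u, v} \<in> edges G \<longleftrightarrow> {f u, f v} \<in> edges H)"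

definition isomorphic :: "'v sgraph \<Rightarrow> 'v sgraph \<Rightarrow> bool" where
  "isomorphic G H \<longleftrightarrow> (\<exists>f. graph_iso f G H)"


section \<open>Graph operations\<close>

text \<open>An operation is a relation: \<open>\<gamma> G H\<close> means that one application of \<open>\<gamma>\<close> to \<open>G\<close>,
  for some choice of its vertex sets, yields \<open>H\<close>. Complementing the edges inside a set of
  pairs is taking the symmetric difference of the edge set with that set of pairs.\<close>

definition complement_edges :: "'v set set \<Rightarrow> 'v sgraph \<Rightarrow> 'v sgraph" where
  "complement_edges P G = \<lparr>verts = verts G, edges = sym_diff (edges G) P\<rparr>"

definition subgraph_complementation :: "'v sgraph \<Rightarrow> 'v sgraph \<Rightarrow> bool" where
  "subgraph_complementation G H \<longleftrightarrow>
     (\<exists>S \<subseteq> verts G. H = complement_edges {{u, v} |u v. u \<in> S \<and> v \<in> S \<and> u \<noteq> v} G)"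

definition bipartite_complementation :: "'v sgraph \<Rightarrow> 'v sgraph \<Rightarrow> bool" where
  "bipartite_complementation G H \<longleftrightarrow>
     (\<exists>X Y. X \<subseteq> verts G \<and> Y \<subseteq> verts G \<and> X \<inter> Y = {} \<and>
        H = complement_edges {{x, y} |x y. x \<in> X \<and> y \<in> Y} G)"

definition vertex_deletion :: "'v sgraph \<Rightarrow> 'v sgraph \<Rightarrow> bool" where
  "vertex_deletion G H \<longleftrightarrow>
     (\<exists>v\<in>verts G. H = \<lparr>verts = verts G - {v}, edges = {e \<in> edges G. v \<notin> e}\<rparr>)"

text \<open>Graphs are regarded up to isomorphism here: the result of the operations only has to be
  isomorphic to the member of the class. For classes closed under isomorphism over an infinite
  vertex type this is the same as asking for equality.\<close>

definition obtained_from ::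
  "nat \<Rightarrow> ('v sgraph \<Rightarrow> 'v sgraph \<Rightarrow> bool) \<Rightarrow> 'v sgraph \<Rightarrow> 'v sgraph \<Rightarrow> bool" where
  "obtained_from k \<gamma> G H \<longleftrightarrow> (\<exists>m\<le>k. \<exists>H'. (\<gamma> ^^ m) G H' \<and> isomorphic H' H)"

definition class_obtained_from ::
  "nat \<Rightarrow> ('v sgraph \<Rightarrow> 'v sgraph \<Rightarrow> bool) \<Rightarrow> 'v sgraph set \<Rightarrow> 'v sgraph set \<Rightarrow> bool" where
  "class_obtained_from k \<gamma> \<G> \<G>' \<longleftrightarrow>
     (\<forall>H\<in>\<G>'. \<exists>G\<in>\<G>. obtained_from k \<gamma> G H) \<and>
     (\<forall>G\<in>\<G>. \<exists>H\<in>\<G>'. obtained_from k \<gamma> G H)"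


section \<open>Well-quasi-orderability by the labelled induced subgraph relation\<close>

definition wqo_on :: "'w set \<Rightarrow> ('w \<Rightarrow> 'w \<Rightarrow> bool) \<Rightarrow> bool" where
  "wqo_on W le \<longleftrightarrow> reflp_on W le \<and> transp_on W le \<and>
     (\<forall>x :: nat \<Rightarrow> 'w. (\<forall>i. x i \<in> W) \<longrightarrow> (\<exists>i j. i < j \<and> le (x i) (x j)))"

text \<open>A labelled graph is a pair of a graph and a labelling function; the values of the function
  outside the vertex set are irrelevant.\<close>

type_synonym ('v, 'w) lgraph = "'v sgraph \<times> ('v \<Rightarrow> 'w)"

definition labelled_induced_subgraph ::
  "('w \<Rightarrow> 'w \<Rightarrow> bool) \<Rightarrow> ('v, 'w) lgraph \<Rightarrow> ('v, 'w) lgraph \<Rightarrow> bool" where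
  "labelled_induced_subgraph le A B \<longleftrightarrow>
     (\<exists>U f. U \<subseteq> verts (fst B) \<and> graph_iso f (fst A) (induced (fst B) U) \<and>
        (\<forall>v\<in>verts (fst A). le (snd A v) (snd B (f v))))"

definition labellings :: "'v sgraph set \<Rightarrow> 'w set \<Rightarrow> ('v, 'w) lgraph set" where
  "labellings X W = {(G, l). G \<in> X \<and> l ` verts G \<subseteq> W}"

definition antichain :: "('a \<Rightarrow> 'a \<Rightarrow> bool) \<Rightarrow> 'a set \<Rightarrow> bool" where
  "antichain r A \<longleftrightarrow> (\<forall>a\<in>A. \<forall>b\<in>A. a \<noteq> b \<longrightarrow> \<not> r a b \<and> \<not> r b a)"

text \<open>Quantification over all well-quasi-orders \<open>(W, \<le>)\<close> becomes quantification over all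
  well-quasi-orders carried by subsets of a label type \<open>'w\<close>. The choice of \<open>'w\<close> does not matter
  as long as it is infinite: see \<open>labelled_wqo_universe\<close> and \<open>labelled_wqo_universe_iff\<close>.\<close>

definition labelled_wqo :: "'w itself \<Rightarrow> 'v sgraph set \<Rightarrow> bool" where
  "labelled_wqo TYPE('w) X \<longleftrightarrow>
     (\<forall>(W :: 'w set) le. wqo_on W le \<longrightarrow>
        \<not> (\<exists>A \<subseteq> labellings X W. infinite A \<and> antichain (labelled_induced_subgraph le) A))"

definition preserves_labelled_wqo ::
  "'w itself \<Rightarrow> ('v sgraph \<Rightarrow> 'v sgraph \<Rightarrow> bool) \<Rightarrow> bool" where
  "preserves_labelled_wqo TYPE('w) \<gamma> \<longleftrightarrow>
     (\<forall>k \<G> \<G>'. graph_class \<G> \<and> graph_class \<G>' \<and> class_obtained_from k \<gamma> \<G> \<G>' \<longrightarrow>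
        (labelled_wqo TYPE('w) \<G>' \<longleftrightarrow> labelled_wqo TYPE('w) \<G>))"

text \<open>An infinite antichain contains a countable one, which uses only countably many labels, and
  these can be renamed injectively into any infinite type.\<close>

lemma labelled_wqo_universe:
  fixes X :: "'v sgraph set"
  assumes X: "graph_class X" and inf: "infinite (UNIV :: 'w set)"
    and wqo: "labelled_wqo TYPE('w) X"
  shows "labelled_wqo TYPE('u) X"
  unfolding labelled_wqo_def
proof (intro allI impI notI)
  fix W :: "'u set" and le
  assume W: "wqo_on W le"
    and "\<exists>A \<subseteq> labellings X W. infinite A \<and> antichain (labelled_induced_subgraph le) A"
  then obtain A where A: "A \<subseteq> labellings X W" "infinite A"
    "antichain (labelled_induced_subgraph le) A"
    by blast
  obtain B where B: "B \<subseteq> A" "infinite B" "countable B"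
    using infinite_countable_subset'[OF A(2)] by blast
  define V where "V = (\<Union>a\<in>B. snd a ` verts (fst a))"
  have fin: "finite (verts (fst a))" if "a \<in> B" for a
    using that A(1) B(1) X by (auto simp: labellings_def graph_class_def simple_graph_def)
  have VW: "V \<subseteq> W"
    using A(1) B(1) by (fastforce simp: V_def labellings_def)
  have "countable V"
    unfolding V_def using B(3) fin by (simp add: countable_finite)
  then obtain g :: "'u \<Rightarrow> nat" where g: "inj_on g V"
    by (auto simp: countable_def)
  obtain h :: "nat \<Rightarrow> 'w" where h: "inj h"
    using infinite_countable_subset[OF inf] by blast
  define c where "c = h \<circ> g"
  have c: "inj_on c V"
    unfolding c_def using g h by (simp add: comp_inj_on inj_on_subset)
  define le' where "le' x y = le (inv_into V c x) (inv_into V c y)" for x y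
  have le'_c: "le' (c x) (c y) = le x y" if "x \<in> V" "y \<in> V" for x y
    using that c by (simp add: le'_def)
  have lab: "snd a v \<in> V" if "a \<in> B" "v \<in> verts (fst a)" for a v
    using that by (auto simp: V_def)
  have rW: "reflp_on V le" and tW: "transp_on V le"
    using W VW by (auto simp: wqo_on_def intro: reflp_on_subset transp_on_subset)
  have wqo': "wqo_on (c ` V) le'"
    unfolding wqo_on_def
  proof (intro conjI allI impI)
    show "reflp_on (c ` V) le'"
      using rW by (auto simp: reflp_on_def le'_c)
    show "transp_on (c ` V) le'"
    proof (rule transp_onI)
      fix x y z
      assume "x \<in> c ` V" "y \<in> c ` V" "z \<in> c ` V" and le: "le' x y" "le' y z"
      then obtain a b d where "a \<in> V" "b \<in> V" "d \<in> V" "x = c a" "y = c b" "z = c d"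
        by blast
      then show "le' x z"
        using transp_onD[OF tW, of a b d] le by (simp add: le'_c)
    qed
    fix x :: "nat \<Rightarrow> 'w"
    assume x: "\<forall>i. x i \<in> c ` V"
    define y where "y i = inv_into V c (x i)" for i
    have "\<forall>i. y i \<in> W"
      unfolding y_def using x VW inv_into_into[of _ c V] by blast
    then obtain i j where "i < j" "le (y i) (y j)"
      using W unfolding wqo_on_def by blast
    then show "\<exists>i j. i < j \<and> le' (x i) (x j)"
      unfolding le'_def y_def by blast
  qed
  define \<phi> where "\<phi> a = (fst a, c \<circ> snd a)" for a :: "('v, 'u) lgraph"
  have sub: "labelled_induced_subgraph le' (\<phi> a) (\<phi> b) \<longleftrightarrow> labelled_induced_subgraph le a b"
    if "a \<in> B" "b \<in> B" for a b
  proof -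
    have "le' (c (snd a v)) (c (snd b (f v))) \<longleftrightarrow> le (snd a v) (snd b (f v))"
      if "U \<subseteq> verts (fst b)" "graph_iso f (fst a) (induced (fst b) U)" "v \<in> verts (fst a)"
      for U f v
    proof -
      have "f v \<in> verts (fst b)"
        using that by (auto simp: graph_iso_def induced_def bij_betw_def)
      then show ?thesis
        using that \<open>a \<in> B\<close> \<open>b \<in> B\<close> by (simp add: le'_c lab)
    qed
    then show ?thesis
      unfolding labelled_induced_subgraph_def \<phi>_def fst_conv snd_conv o_apply by meson
  qed
  have refl: "labelled_induced_subgraph le a a" if "a \<in> B" for a
  proof -
    have "graph_iso id (fst a) (induced (fst a) (verts (fst a)))"
      by (simp add: graph_iso_def induced_def)
    moreover have "\<forall>v\<in>verts (fst a). le (snd a v) (snd a v)"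
      using that rW lab by (auto simp: reflp_on_def)
    ultimately show ?thesis
      unfolding labelled_induced_subgraph_def
      by (intro exI[of _ "verts (fst a)"] exI[of _ id]) simp
  qed
  have anti: "a = b" if "a \<in> B" "b \<in> B" "labelled_induced_subgraph le a b" for a b
    using that A(3) B(1) by (auto simp: antichain_def)
  have inj: "inj_on \<phi> B"
  proof (rule inj_onI)
    fix a b
    assume "a \<in> B" "b \<in> B" "\<phi> a = \<phi> b"
    then have "labelled_induced_subgraph le a b"
      using sub[of a b] sub[of a a] refl[of a] by simp
    then show "a = b"
      using anti \<open>a \<in> B\<close> \<open>b \<in> B\<close> by blast
  qed
  have "\<phi> ` B \<subseteq> labellings X (c ` V)"
  proof
    fix b
    assume "b \<in> \<phi> ` B"
    then obtain a where a: "a \<in> B" "b = \<phi> a"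
      by blast
    then have "fst a \<in> X"
      using A(1) B(1) by (auto simp: labellings_def)
    then show "b \<in> labellings X (c ` V)"
      using a lab[OF a(1)] by (auto simp: labellings_def \<phi>_def)
  qed
  moreover have "infinite (\<phi> ` B)"
    using inj B(2) by (simp add: finite_image_iff)
  moreover have "antichain (labelled_induced_subgraph le') (\<phi> ` B)"
  proof -
    have "\<not> labelled_induced_subgraph le' (\<phi> a) (\<phi> b)" if "a \<in> B" "b \<in> B" "\<phi> a \<noteq> \<phi> b" for a b
      using that sub[of a b] anti[of a b] by blast
    then show ?thesis
      unfolding antichain_def ball_simps by metis
  qed
  ultimately show False
    using wqo wqo' unfolding labelled_wqo_def by blast
qed

corollary labelled_wqo_universe_iff:
  assumes "graph_class X" "infinite (UNIV :: 'w set)" "infinite (UNIV :: 'u set)"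
  shows "labelled_wqo TYPE('w) X \<longleftrightarrow> labelled_wqo TYPE('u) X"
  using labelled_wqo_universe[OF assms(1,2)] labelled_wqo_universe[OF assms(1,3)] by (rule iffI)

end

theory Submission
  imports Defs "HOL-Library.Ramsey"
begin

text \<open>
  Take an infinite antichain of labelled graphs in one class. Each of its members is obtained by
  one operation from a graph of the other class, and the operation can be written into the labels
  of that graph: whether a vertex belongs to the complemented sets, whether it is the deleted
  vertex, or, for the reverse of a deletion, whether it is adjacent to the restored vertex, together
  with the label of the restored vertex. The enriched labels are still well-quasi-ordered, and an
  embedding for the enriched labels yields one of the original graphs, so that the enriched graphs
  form an infinite antichain in the other class. Several operations are handled one at a time.
\<close>

section \<open>Well-quasi-orders of labels\<close>

lemma wqo_on_good_pair:
  assumes "wqo_on W le" "\<And>i :: nat. x i \<in> W"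
  obtains i j where "i < j" "le (x i) (x j)"
  using assms unfolding wqo_on_def by blast

text \<open>Ramsey's theorem for pairs of indices, coloured by whether the earlier term lies below
  the later one. A homogeneous set of the wrong colour would give a sequence in \<open>W\<close>
  without a good pair. Products need this strengthening of good pairs.\<close>

lemma wqo_on_increasing_subseq:
  fixes x :: "nat \<Rightarrow> 'a"
  assumes W: "wqo_on W le" and x: "\<And>i. x i \<in> W"
  obtains r :: "nat \<Rightarrow> nat" where "strict_mono r" "\<And>i j. i < j \<Longrightarrow> le (x (r i)) (x (r j))"
proof -
  \<comment> \<open>Ramsey's theorem colours unordered pairs; \<open>Min\<close> and
    \<open>Max\<close> recover the order of the two indices.\<close>
  define f where "f e = (if le (x (Min e)) (x (Max e)) then 0 else 1 :: nat)" for e :: "nat set"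
  have "\<forall>i\<in>(UNIV :: nat set). \<forall>j\<in>UNIV. i \<noteq> j \<longrightarrow> f {i, j} < 2"
    by (simp add: f_def)
  from Ramsey2[OF infinite_UNIV_nat this] obtain Y :: "nat set" and t where Y: "infinite Y"
    and t: "\<forall>i\<in>Y. \<forall>j\<in>Y. i \<noteq> j \<longrightarrow> f {i, j} = t"
    by blast
  define r where "r = enumerate Y"
  have r: "strict_mono r" "\<And>i. r i \<in> Y"
    using Y by (simp_all add: r_def strict_mono_enumerate enumerate_in_set)
  have f: "f {r i, r j} = (if le (x (r i)) (x (r j)) then 0 else 1)" if "i < j" for i j
  proof -
    have "r i < r j"
      using r(1) that by (simp add: strict_monoD)
    then show ?thesis
      by (simp add: f_def)
  qed
  have ft: "f {r i, r j} = t" if "i < j" for i j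
    using t r that by (metis less_irrefl strict_monoD)
  \<comment> \<open>A single good pair within the homogeneous subsequence decides the colour of all
    its pairs.\<close>
  obtain i j where "i < j" "le (x (r i)) (x (r j))"
    by (rule wqo_on_good_pair[OF W, of "\<lambda>i. x (r i)"]) (rule x)
  then have "t = 0"
    using f ft by (metis)
  then have "le (x (r i)) (x (r j))" if "i < j" for i j
    using f[OF that] ft[OF that] by (simp split: if_splits)
  with r(1) show thesis
    using that by blast
qed

text \<open>Pass to a subsequence whose first components increase; there, any good pair of second
  components is good in both.\<close>

lemma wqo_on_Times:
  assumes V: "wqo_on V p" and W: "wqo_on W q"
  shows "wqo_on (V \<times> W) (rel_prod p q)"
  unfolding wqo_on_def
proof (intro conjI allI impI)
  show "reflp_on (V \<times> W) (rel_prod p q)"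
    using V W by (auto simp: wqo_on_def reflp_on_def)
  show "transp_on (V \<times> W) (rel_prod p q)"
  proof (rule transp_onI)
    have t: "transp_on V p" "transp_on W q"
      using V W by (simp_all add: wqo_on_def)
    fix x y z
    assume "x \<in> V \<times> W" "y \<in> V \<times> W" "z \<in> V \<times> W" "rel_prod p q x y" "rel_prod p q y z"
    then show "rel_prod p q x z"
      using transp_onD[OF t(1), of "fst x" "fst y" "fst z"]
        transp_onD[OF t(2), of "snd x" "snd y" "snd z"]
      by (simp add: rel_prod_sel mem_Times_iff)
  qed
  fix x :: "nat \<Rightarrow> 'a \<times> 'b"
  assume x: "\<forall>i. x i \<in> V \<times> W"
  obtain r :: "nat \<Rightarrow> nat" where r: "strict_mono r"
    "\<And>i j. i < j \<Longrightarrow> p (fst (x (r i))) (fst (x (r j)))"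
    by (rule wqo_on_increasing_subseq[OF V, of "\<lambda>i. fst (x i)"])
      (use x in \<open>auto simp: mem_Times_iff\<close>)
  obtain i j where ij: "i < j" "q (snd (x (r i))) (snd (x (r j)))"
    by (rule wqo_on_good_pair[OF W, of "\<lambda>i. snd (x (r i))"])
      (use x in \<open>auto simp: mem_Times_iff\<close>)
  then have "rel_prod p q (x (r i)) (x (r j))"
    using r(2) by (simp add: rel_prod_sel)
  then show "\<exists>i j. i < j \<and> rel_prod p q (x i) (x j)"
    using ij(1) r(1) by (meson strict_monoD)
qed

text \<open>Finite information attached to a vertex is ordered by equality, so that an embedding has
  to preserve it exactly. Two equal terms exist by the pigeonhole principle.\<close>

lemma wqo_on_finite_eq: "wqo_on (UNIV :: 'c::finite set) (=)"
  unfolding wqo_on_def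
proof (intro conjI allI impI)
  fix x :: "nat \<Rightarrow> 'c"
  have "\<not> inj x"
    using finite_imageD[of x UNIV] by auto
  then obtain i j where "i \<noteq> j" "x i = x j"
    by (auto simp: inj_def)
  then show "\<exists>i j. i < j \<and> x i = x j"
    by (metis linorder_neqE_nat)
qed (auto simp: reflp_on_def transp_on_def)

text \<open>Under \<open>rel_option\<close>, \<open>None\<close> is comparable only with itself, so
  it can mark a vertex that embeddings must respect. A sequence either takes the value
  \<open>None\<close> twice or eventually avoids it, and then its tail is a sequence in
  \<open>W\<close>.\<close>

lemma wqo_on_option:
  assumes W: "wqo_on W le"
  shows "wqo_on (insert None (Some ` W)) (rel_option le)"
  unfolding wqo_on_def
proof (intro conjI allI impI)
  show "reflp_on (insert None (Some ` W)) (rel_option le)"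
    using W by (auto simp: wqo_on_def reflp_on_def)
  show "transp_on (insert None (Some ` W)) (rel_option le)"
  proof (rule transp_onI)
    have t: "transp_on W le"
      using W by (simp add: wqo_on_def)
    fix x y z
    assume "x \<in> insert None (Some ` W)" "y \<in> insert None (Some ` W)" "z \<in> insert None (Some ` W)"
      and "rel_option le x y" "rel_option le y z"
    then show "rel_option le x z"
      using transp_onD[OF t, of "the x" "the y" "the z"] by auto
  qed
  fix x :: "nat \<Rightarrow> 'a option"
  assume x: "\<forall>i. x i \<in> insert None (Some ` W)"
  show "\<exists>i j. i < j \<and> rel_option le (x i) (x j)"
  proof (cases "\<exists>n. \<forall>i\<ge>n. x i \<noteq> None")
    case True
    then obtain n where n: "\<And>i. x (i + n) \<noteq> None"
      by (meson le_add2)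
    define y where "y i = the (x (i + n))" for i
    have y: "x (i + n) = Some (y i)" for i
      using n[of i] by (simp add: y_def)
    have yW: "y i \<in> W" for i
      using x[rule_format, of "i + n"] by (auto simp: y)
    obtain i j where "i < j" "le (y i) (y j)"
      by (rule wqo_on_good_pair[OF W, of y]) (rule yW)
    then have "i + n < j + n" "rel_option le (x (i + n)) (x (j + n))"
      by (simp_all add: y)
    then show ?thesis
      by blast
  next
    case False
    then obtain i j where "x i = None" "x j = None" "i < j"
      by (metis Suc_le_eq)
    then show ?thesis
      by (metis option.rel_intros(1))
  qed
qed

section \<open>Labelled embeddings and antichains\<close>

text \<open>The set \<open>U\<close> is forced to be the image of \<open>f\<close>, and an edge
  between image vertices always lies inside \<open>U\<close>. This removes \<open>induced\<close>
  from all later arguments, leaving only a map to construct.\<close>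

lemma labelled_induced_subgraph_iff:
  "labelled_induced_subgraph le (G, l) (H, m) \<longleftrightarrow>
     (\<exists>f. inj_on f (verts G) \<and> f ` verts G \<subseteq> verts H \<and>
        (\<forall>u\<in>verts G. \<forall>v\<in>verts G. {u, v} \<in> edges G \<longleftrightarrow> {f u, f v} \<in> edges H) \<and>
        (\<forall>v\<in>verts G. le (l v) (m (f v))))"
  (is "?L \<longleftrightarrow> ?R")
proof
  assume ?L
  then obtain U f where f: "U \<subseteq> verts H" "graph_iso f G (induced H U)"
    "\<forall>v\<in>verts G. le (l v) (m (f v))"
    by (auto simp: labelled_induced_subgraph_def)
  then have U: "inj_on f (verts G)" "f ` verts G = U"
    by (auto simp: graph_iso_def induced_def bij_betw_def)
  then have "{u, v} \<in> edges G \<longleftrightarrow> {f u, f v} \<in> edges H" if "u \<in> verts G" "v \<in> verts G" for u v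
    using f(2) that by (auto simp: graph_iso_def induced_def)
  with f U show ?R
    by blast
next
  assume ?R
  then obtain f where "inj_on f (verts G)" "f ` verts G \<subseteq> verts H"
    "\<forall>u\<in>verts G. \<forall>v\<in>verts G. {u, v} \<in> edges G \<longleftrightarrow> {f u, f v} \<in> edges H"
    "\<forall>v\<in>verts G. le (l v) (m (f v))"
    by blast
  then show ?L
    unfolding labelled_induced_subgraph_def
    by (intro exI[of _ "f ` verts G"] exI[of _ f])
      (auto simp: graph_iso_def induced_def bij_betw_def)
qed

lemma labelled_induced_subgraph_refl:
  assumes "reflp_on W le" "a \<in> labellings X W"
  shows "labelled_induced_subgraph le a a"
proof (cases a)
  case (Pair G l)
  then show ?thesis
    using assms unfolding Pair labelled_induced_subgraph_iff
    by (intro exI[of _ id]) (auto simp: labellings_def reflp_on_def)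
qed

text \<open>The common engine of all transfer results. \<open>P a b\<close> is read as: the labelled
  graph \<open>b\<close> over \<open>X\<close> encodes \<open>a\<close>. If embeddings between codes
  always give embeddings between the encoded graphs, then a choice of codes turns \<open>A\<close>
  into an infinite antichain over \<open>X\<close>. The codes may use another label type than
  \<open>A\<close>.\<close>

lemma labelled_wqo_no_antichain_by_reflection:
  assumes X: "labelled_wqo TYPE('u) (X :: 'v sgraph set)" and W: "wqo_on (W :: 'u set) le'"
    and A: "infinite A" "antichain (labelled_induced_subgraph le) A"
    and ex: "\<And>a. a \<in> A \<Longrightarrow> \<exists>b \<in> labellings X W. P a b"
    and reflect: "\<And>a b a' b'. \<lbrakk>a \<in> A; a' \<in> A; P a b; P a' b'; labelled_induced_subgraph le' b b'\<rbrakk>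
      \<Longrightarrow> labelled_induced_subgraph le a a'"
  shows False
proof -
  obtain \<phi> where \<phi>: "\<And>a. a \<in> A \<Longrightarrow> \<phi> a \<in> labellings X W" "\<And>a. a \<in> A \<Longrightarrow> P a (\<phi> a)"
    using ex by metis
  have eq: "a = a'" if "a \<in> A" "a' \<in> A" "labelled_induced_subgraph le' (\<phi> a) (\<phi> a')" for a a'
    using reflect[OF that(1,2) \<phi>(2) \<phi>(2) that(3)] A(2) that(1,2) by (auto simp: antichain_def)
  \<comment> \<open>Injectivity keeps the image infinite. Equal codes embed into each other by
    reflexivity, so the encoded graphs are comparable and hence equal.\<close>
  have "inj_on \<phi> A"
  proof (rule inj_onI)
    fix a a' assume "a \<in> A" "a' \<in> A" "\<phi> a = \<phi> a'"
    then show "a = a'"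
      using eq labelled_induced_subgraph_refl[OF _ \<phi>(1), of le' a] W by (simp add: wqo_on_def)
  qed
  then have "infinite (\<phi> ` A)"
    using A(1) by (simp add: finite_image_iff)
  moreover have "antichain (labelled_induced_subgraph le') (\<phi> ` A)"
    using eq unfolding antichain_def by blast
  moreover have "\<phi> ` A \<subseteq> labellings X W"
    using \<phi>(1) by blast
  ultimately show False
    using X W unfolding labelled_wqo_def by blast
qed

section \<open>Subclasses and finite unions of classes\<close>

lemma labelled_wqo_subset:
  assumes "labelled_wqo TYPE('w) Y" "X \<subseteq> Y"
  shows "labelled_wqo TYPE('w) X"
proof -
  have "labellings X W \<subseteq> labellings Y W" for W :: "'w set"
    using assms(2) by (auto simp: labellings_def)
  then show ?thesis
    using assms(1) unfolding labelled_wqo_def by (meson order_trans)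
qed

text \<open>An infinite antichain over the union has infinitely many members over one of the
  finitely many classes, and a subset of an antichain is an antichain.\<close>

lemma labelled_wqo_UN:
  assumes "finite I" "\<And>i. i \<in> I \<Longrightarrow> labelled_wqo TYPE('w) (X i)"
  shows "labelled_wqo TYPE('w) (\<Union>i\<in>I. X i)"
  unfolding labelled_wqo_def
proof (intro allI impI notI)
  fix W :: "'w set" and le
  assume W: "wqo_on W le"
    and "\<exists>A \<subseteq> labellings (\<Union>i\<in>I. X i) W. infinite A \<and> antichain (labelled_induced_subgraph le) A"
  then obtain A where A: "A \<subseteq> labellings (\<Union>i\<in>I. X i) W" "infinite A"
    "antichain (labelled_induced_subgraph le) A"
    by blast
  have "A = (\<Union>i\<in>I. A \<inter> labellings (X i) W)"
    using A(1) by (fastforce simp: labellings_def)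
  then obtain i where i: "i \<in> I" "infinite (A \<inter> labellings (X i) W)"
    using A(2) assms(1) by (metis finite_UN_I)
  moreover have "antichain (labelled_induced_subgraph le) (A \<inter> labellings (X i) W)"
    using A(3) by (auto simp: antichain_def)
  ultimately show False
    using assms(2)[OF i(1)] W unfolding labelled_wqo_def by blast
qed

section \<open>Relations transferring labelled well-quasi-orderability\<close>

text \<open>The restriction to simple graphs matters for converses: undoing a vertex deletion could
  also restore a vertex with a loop.\<close>

definition graph_image :: "('v sgraph \<Rightarrow> 'v sgraph \<Rightarrow> bool) \<Rightarrow> 'v sgraph set \<Rightarrow> 'v sgraph set" where
  "graph_image R X = {H. simple_graph H \<and> (\<exists>G\<in>X. R G H)}"

text \<open>Stated for arbitrary relations so that it applies alike to an operation, to its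
  converse, to their iterates and to isomorphism. The image is the largest class of simple graphs
  reachable from \<open>X\<close>; smaller classes follow by
  \<open>labelled_wqo_subset\<close>.\<close>

definition transfers_labelled_wqo ::
  "'w itself \<Rightarrow> ('v sgraph \<Rightarrow> 'v sgraph \<Rightarrow> bool) \<Rightarrow> bool" where
  "transfers_labelled_wqo TYPE('w) R \<longleftrightarrow>
     (\<forall>X. graph_class X \<and> labelled_wqo TYPE('w) X \<longrightarrow> labelled_wqo TYPE('w) (graph_image R X))"

lemma transfers_labelled_wqoI:
  "(\<And>X. graph_class X \<and> labelled_wqo TYPE('w) X \<Longrightarrow> labelled_wqo TYPE('w) (graph_image R X))
    \<Longrightarrow> transfers_labelled_wqo TYPE('w) R"
  by (simp add: transfers_labelled_wqo_def)

lemma transfers_labelled_wqoD: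
  "\<lbrakk>transfers_labelled_wqo TYPE('w) R; graph_class X; labelled_wqo TYPE('w) X\<rbrakk>
    \<Longrightarrow> labelled_wqo TYPE('w) (graph_image R X)"
  by (simp add: transfers_labelled_wqo_def)

lemma graph_class_graph_image: "graph_class (graph_image R X)"
  by (simp add: graph_class_def graph_image_def)

section \<open>Closure of a class under isomorphism\<close>

lemma isomorphic_sym:
  assumes "isomorphic G H" shows "isomorphic H G"
proof -
  obtain f where f: "graph_iso f G H"
    using assms by (auto simp: isomorphic_def)
  then have b: "bij_betw f (verts G) (verts H)"
    by (simp add: graph_iso_def)
  let ?g = "inv_into (verts G) f"
  have "?g v \<in> verts G" "f (?g v) = v" if "v \<in> verts H" for v
    using b that by (auto simp: bij_betw_def inv_into_into f_inv_into_f)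
  then have "graph_iso ?g H G"
    using f bij_betw_inv_into[OF b] by (simp add: graph_iso_def)
  then show ?thesis
    by (auto simp: isomorphic_def)
qed

text \<open>Labels are carried along the isomorphism. This is needed because
  \<open>obtained_from\<close> reaches the members of the second class only up to
  isomorphism.\<close>

lemma transfers_isomorphic:
  "transfers_labelled_wqo TYPE('w) (isomorphic :: 'v sgraph \<Rightarrow> 'v sgraph \<Rightarrow> bool)"
proof (intro transfers_labelled_wqoI, unfold labelled_wqo_def[of "graph_image _ _"], intro allI impI notI)
  fix X :: "'v sgraph set" and W :: "'w set" and le
  assume X: "graph_class X \<and> labelled_wqo TYPE('w) X" and W: "wqo_on W le"
    and "\<exists>A \<subseteq> labellings (graph_image isomorphic X) W.
      infinite A \<and> antichain (labelled_induced_subgraph le) A"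
  then obtain A where A: "A \<subseteq> labellings (graph_image isomorphic X) W" "infinite A"
    "antichain (labelled_induced_subgraph le) A"
    by blast
  define P :: "('v, 'w) lgraph \<Rightarrow> ('v, 'w) lgraph \<Rightarrow> bool" where
    "P = (\<lambda>(H, l) (G, m). \<exists>g. graph_iso g H G \<and> (\<forall>v\<in>verts H. m (g v) = l v))"
  show False
  proof (rule labelled_wqo_no_antichain_by_reflection[OF _ W A(2,3), of X P])
    show "labelled_wqo TYPE('w) X"
      using X by simp
  next
    fix a assume "a \<in> A"
    then obtain H l where a: "a = (H, l)" "H \<in> graph_image isomorphic X" "l ` verts H \<subseteq> W"
      using A(1) by (auto simp: labellings_def)
    then obtain G where G: "G \<in> X" "isomorphic H G"
      by (auto simp: graph_image_def intro: isomorphic_sym)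
    then obtain g where g: "graph_iso g H G"
      by (auto simp: isomorphic_def)
    then have b: "bij_betw g (verts H) (verts G)"
      by (simp add: graph_iso_def)
    let ?m = "l \<circ> inv_into (verts H) g"
    have "?m ` verts G = l ` verts H"
      using bij_betw_inv_into[OF b] by (metis bij_betw_def image_comp)
    then have "(G, ?m) \<in> labellings X W"
      using G a by (simp add: labellings_def)
    moreover have "P a (G, ?m)"
      using g b by (auto simp: P_def a bij_betw_def)
    ultimately show "\<exists>b\<in>labellings X W. P a b"
      by blast
  next
    fix a b a' b'
    assume "P a b" "P a' b'" and le: "labelled_induced_subgraph le b b'"
    obtain H l G m where ab: "a = (H, l)" "b = (G, m)"
      by (cases a, cases b)
    obtain H' l' G' m' where ab': "a' = (H', l')" "b' = (G', m')"
      by (cases a', cases b')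
    obtain g where g: "graph_iso g H G" "\<forall>v\<in>verts H. m (g v) = l v"
      using \<open>P a b\<close> by (auto simp: P_def ab)
    obtain h where h: "graph_iso h H' G'" "\<forall>v\<in>verts H'. m' (h v) = l' v"
      using \<open>P a' b'\<close> by (auto simp: P_def ab')
    obtain f where f: "inj_on f (verts G)" "f ` verts G \<subseteq> verts G'"
        "\<And>u v. u \<in> verts G \<Longrightarrow> v \<in> verts G \<Longrightarrow> {u, v} \<in> edges G \<longleftrightarrow> {f u, f v} \<in> edges G'"
        "\<And>v. v \<in> verts G \<Longrightarrow> le (m v) (m' (f v))"
      using le by (auto simp: ab ab' labelled_induced_subgraph_iff)
    have bg: "inj_on g (verts H)" "g ` verts H = verts G"
      using g by (auto simp: graph_iso_def bij_betw_def)
    have bh: "inj_on h (verts H')" "h ` verts H' = verts G'"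
      using h by (auto simp: graph_iso_def bij_betw_def)
    let ?k = "inv_into (verts H') h"
    have k: "?k w \<in> verts H'" "h (?k w) = w" if "w \<in> verts G'" for w
      using bh that by (auto simp: inv_into_into f_inv_into_f)
    have fg: "g v \<in> verts G" "f (g v) \<in> verts G'" if "v \<in> verts H" for v
      using bg f that by auto
    show "labelled_induced_subgraph le a a'"
      unfolding ab ab' labelled_induced_subgraph_iff
    \<comment> \<open>Go from \<open>H\<close> to its copy \<open>G\<close>, embed that into
      \<open>G'\<close>, and return to \<open>H'\<close> by the inverse of \<open>h\<close>.\<close>
    proof (intro exI[of _ "?k \<circ> f \<circ> g"] conjI ballI)
      have "inj_on ?k (verts G')"
        using bh by (simp add: inj_on_inv_into)
      then show "inj_on (?k \<circ> f \<circ> g) (verts H)"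
        using bg f by (intro comp_inj_on) (auto intro: inj_on_subset)
      show "(?k \<circ> f \<circ> g) ` verts H \<subseteq> verts H'"
        using fg k by auto
    next
      fix u v assume uv: "u \<in> verts H" "v \<in> verts H"
      have "{u, v} \<in> edges H \<longleftrightarrow> {g u, g v} \<in> edges G"
        using g(1) uv by (simp add: graph_iso_def)
      also have "\<dots> \<longleftrightarrow> {f (g u), f (g v)} \<in> edges G'"
        using f(3) fg uv by simp
      also have "\<dots> \<longleftrightarrow> {?k (f (g u)), ?k (f (g v))} \<in> edges H'"
        using h(1) fg(2)[OF uv(1)] fg(2)[OF uv(2)] k by (simp add: graph_iso_def)
      finally show "{u, v} \<in> edges H \<longleftrightarrow> {(?k \<circ> f \<circ> g) u, (?k \<circ> f \<circ> g) v} \<in> edges H'"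
        by simp
    next
      fix v assume v: "v \<in> verts H"
      show "le (l v) (l' ((?k \<circ> f \<circ> g) v))"
        using f(4)[OF fg(1)[OF v]] g(2) h(2) k[OF fg(2)[OF v]] v by (metis comp_apply)
    qed
  qed
qed

section \<open>Iterates of an operation and of its converse\<close>

lemma simple_graph_relpowp:
  fixes \<gamma> :: "'v sgraph \<Rightarrow> 'v sgraph \<Rightarrow> bool"
  assumes "\<And>G H. simple_graph G \<Longrightarrow> \<gamma> G H \<Longrightarrow> simple_graph H"
    and "(\<gamma> ^^ m) G H" "simple_graph G"
  shows "simple_graph H"
  using assms(2,3) by (induction m arbitrary: H) (auto intro: assms(1))

text \<open>Since the operation keeps graphs simple, the intermediate graph before the last step is
  not lost by the restriction in \<open>graph_image\<close>.\<close>

lemma graph_image_relpowp_Suc: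
  assumes "\<And>G H. simple_graph G \<Longrightarrow> \<gamma> G H \<Longrightarrow> simple_graph H" "graph_class X"
  shows "graph_image (\<gamma> ^^ Suc m) X \<subseteq> graph_image \<gamma> (graph_image (\<gamma> ^^ m) X)"
proof -
  have "simple_graph H" if "(\<gamma> ^^ m) G H" "simple_graph G" for G H
    using simple_graph_relpowp that assms(1) by blast
  then show ?thesis
    using assms(2) by (fastforce simp: graph_image_def graph_class_def)
qed

lemma graph_image_relpowp_conversep_Suc:
  assumes "\<And>G H. simple_graph G \<Longrightarrow> \<gamma> G H \<Longrightarrow> simple_graph H"
  shows "graph_image (\<gamma> ^^ Suc m)\<inverse>\<inverse> X \<subseteq> graph_image \<gamma>\<inverse>\<inverse> (graph_image (\<gamma> ^^ m)\<inverse>\<inverse> X)"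
proof
  fix G assume "G \<in> graph_image (\<gamma> ^^ Suc m)\<inverse>\<inverse> X"
  then obtain H where H: "simple_graph G" "H \<in> X" "(\<gamma> ^^ Suc m) G H"
    by (auto simp: graph_image_def)
  \<comment> \<open>Here the first step is split off rather than the last: coming back from
    \<open>H\<close>, it is the one undone at the end. The intermediate graph \<open>G'\<close> is
    simple because it arises from the simple graph \<open>G\<close>.\<close>
  then obtain G' where "\<gamma> G G'" "(\<gamma> ^^ m) G' H"
    by (meson relpowp_Suc_D2)
  then show "G \<in> graph_image \<gamma>\<inverse>\<inverse> (graph_image (\<gamma> ^^ m)\<inverse>\<inverse> X)"
    using H assms by (auto simp: graph_image_def)
qed

lemma graph_image_zero: "graph_image (\<gamma> ^^ 0) X \<subseteq> X" "graph_image (\<gamma> ^^ 0)\<inverse>\<inverse> X \<subseteq> X"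
  by (auto simp: graph_image_def)

lemma transfers_relpowp:
  assumes "transfers_labelled_wqo TYPE('w) \<gamma>"
    and "\<And>G H. simple_graph G \<Longrightarrow> \<gamma> G H \<Longrightarrow> simple_graph H"
  shows "transfers_labelled_wqo TYPE('w) (\<gamma> ^^ m)"
proof (induction m)
  case 0
  show ?case
    by (intro transfers_labelled_wqoI labelled_wqo_subset[OF _ graph_image_zero(1)]) simp
next
  case (Suc m)
  show ?case
  proof (rule transfers_labelled_wqoI, erule conjE)
    fix X :: "'a sgraph set" assume X: "graph_class X" "labelled_wqo TYPE('w) X"
    show "labelled_wqo TYPE('w) (graph_image (\<gamma> ^^ Suc m) X)"
      by (rule labelled_wqo_subset[OF transfers_labelled_wqoD[OF assms(1) graph_class_graph_image
              transfers_labelled_wqoD[OF Suc X]] graph_image_relpowp_Suc[OF assms(2) X(1)]])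
  qed
qed

lemma transfers_relpowp_conversep:
  assumes "transfers_labelled_wqo TYPE('w) \<gamma>\<inverse>\<inverse>"
    and "\<And>G H. simple_graph G \<Longrightarrow> \<gamma> G H \<Longrightarrow> simple_graph H"
  shows "transfers_labelled_wqo TYPE('w) (\<gamma> ^^ m)\<inverse>\<inverse>"
proof (induction m)
  case 0
  show ?case
    by (intro transfers_labelled_wqoI labelled_wqo_subset[OF _ graph_image_zero(2)]) simp
next
  case (Suc m)
  show ?case
  proof (rule transfers_labelled_wqoI, erule conjE)
    fix X :: "'a sgraph set" assume X: "graph_class X" "labelled_wqo TYPE('w) X"
    show "labelled_wqo TYPE('w) (graph_image (\<gamma> ^^ Suc m)\<inverse>\<inverse> X)"
      by (rule labelled_wqo_subset[OF transfers_labelled_wqoD[OF assms(1) graph_class_graph_image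
              transfers_labelled_wqoD[OF Suc X]] graph_image_relpowp_conversep_Suc[OF assms(2)]])
  qed
qed

text \<open>Clause (a) of \<open>class_obtained_from\<close> places the second class, up to
  isomorphism, in the union of the images of the first under at most \<open>k\<close> steps. Clause
  (b) places the first class in a similar union of converse images. Both unions are finite, so the
  transfer results apply.\<close>

lemma preserves_labelled_wqoI:
  assumes fwd: "transfers_labelled_wqo TYPE('w) \<gamma>"
    and bwd: "transfers_labelled_wqo TYPE('w) \<gamma>\<inverse>\<inverse>"
    and simple: "\<And>G H. simple_graph G \<Longrightarrow> \<gamma> G H \<Longrightarrow> simple_graph H"
  shows "preserves_labelled_wqo TYPE('w) \<gamma>"
  unfolding preserves_labelled_wqo_def
proof (intro allI impI iffI; elim conjE)
  fix k \<G> \<G>'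
  assume c: "graph_class \<G>" "graph_class \<G>'" "class_obtained_from k \<gamma> \<G> \<G>'"
  note pow = simple_graph_relpowp[of \<gamma>, OF simple]
  {
    assume w: "labelled_wqo TYPE('w) \<G>"
    let ?Y = "\<Union>m\<in>{..k}. graph_image (\<gamma> ^^ m) \<G>"
    have "labelled_wqo TYPE('w) ?Y"
      by (intro labelled_wqo_UN transfers_labelled_wqoD[OF transfers_relpowp] fwd c(1) w)
        (auto intro: simple)
    moreover have "graph_class ?Y"
      by (auto simp: graph_class_def graph_image_def)
    ultimately have Y: "labelled_wqo TYPE('w) (graph_image isomorphic ?Y)"
      by (intro transfers_labelled_wqoD[OF transfers_isomorphic])
    have "\<G>' \<subseteq> graph_image isomorphic ?Y"
    proof
      fix H assume H: "H \<in> \<G>'"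
      then obtain G m H' where "G \<in> \<G>" "m \<le> k" "(\<gamma> ^^ m) G H'" "isomorphic H' H"
        using c(3) unfolding class_obtained_from_def obtained_from_def by blast
      moreover have "simple_graph H'"
        using pow calculation c(1) by (auto simp: graph_class_def)
      ultimately show "H \<in> graph_image isomorphic ?Y"
        using H c(2) by (auto simp: graph_image_def graph_class_def)
    qed
    then show "labelled_wqo TYPE('w) \<G>'"
      by (rule labelled_wqo_subset[OF Y])
  }
  {
    assume w: "labelled_wqo TYPE('w) \<G>'"
    \<comment> \<open>The isomorphism comes last in \<open>obtained_from\<close>, hence it is undone
      first, before the converse steps.\<close>
    let ?I = "graph_image isomorphic \<G>'"
    have "labelled_wqo TYPE('w) ?I"
      by (intro transfers_labelled_wqoD[OF transfers_isomorphic] w c(2))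
    then have Y: "labelled_wqo TYPE('w) (\<Union>m\<in>{..k}. graph_image (\<gamma> ^^ m)\<inverse>\<inverse> ?I)"
      by (intro labelled_wqo_UN transfers_labelled_wqoD[OF transfers_relpowp_conversep] bwd
          graph_class_graph_image) (auto intro: simple)
    have "\<G> \<subseteq> (\<Union>m\<in>{..k}. graph_image (\<gamma> ^^ m)\<inverse>\<inverse> ?I)"
    proof
      fix G assume G: "G \<in> \<G>"
      then obtain H m H' where "H \<in> \<G>'" "m \<le> k" "(\<gamma> ^^ m) G H'" "isomorphic H' H"
        using c(3) unfolding class_obtained_from_def obtained_from_def by blast
      moreover have "simple_graph H'"
        using pow calculation c(1) G by (auto simp: graph_class_def)
      ultimately show "G \<in> (\<Union>m\<in>{..k}. graph_image (\<gamma> ^^ m)\<inverse>\<inverse> ?I)"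
        using G c(1) isomorphic_sym by (fastforce simp: graph_image_def graph_class_def)
    qed
    then show "labelled_wqo TYPE('w) \<G>"
      by (rule labelled_wqo_subset[OF Y])
  }
qed

section \<open>Complementations\<close>

lemma simple_graph_no_loop: "simple_graph G \<Longrightarrow> {v} \<notin> edges G"
  by (auto simp: simple_graph_def)

text \<open>If finitely many vertex colours decide which pairs are flipped, the colours are added to
  the labels. A colour-preserving embedding sends flipped pairs to flipped pairs and the others to
  the others, so it also embeds the graphs after flipping.\<close>

lemma transfers_recolouring:
  fixes R :: "'v sgraph \<Rightarrow> 'v sgraph \<Rightarrow> bool" and Q :: "'c::finite \<Rightarrow> 'c \<Rightarrow> bool"
  assumes inf: "infinite (UNIV :: 'w set)"
    and R: "\<And>G H. R G H \<Longrightarrow> verts H = verts G \<and> (\<exists>c. \<forall>u v. u \<noteq> v \<longrightarrow>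
      ({u, v} \<in> edges H \<longleftrightarrow> ({u, v} \<in> edges G) \<noteq> Q (c u) (c v)))"
  shows "transfers_labelled_wqo TYPE('w) R"
proof (intro transfers_labelled_wqoI, unfold labelled_wqo_def[of "graph_image _ _"], intro allI impI notI)
  fix X :: "'v sgraph set" and W :: "'w set" and le
  assume X: "graph_class X \<and> labelled_wqo TYPE('w) X" and W: "wqo_on W le"
    and "\<exists>A \<subseteq> labellings (graph_image R X) W.
      infinite A \<and> antichain (labelled_induced_subgraph le) A"
  then obtain A where A: "A \<subseteq> labellings (graph_image R X) W" "infinite A"
    "antichain (labelled_induced_subgraph le) A"
    by blast
  define P :: "('v, 'w) lgraph \<Rightarrow> ('v, 'w \<times> 'c) lgraph \<Rightarrow> bool" where
    "P = (\<lambda>(H, l) (G, m). verts H = verts G \<and> (\<forall>u. fst (m u) = l u) \<and>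
      (\<forall>u v. u \<noteq> v \<longrightarrow>
        ({u, v} \<in> edges H \<longleftrightarrow> ({u, v} \<in> edges G) \<noteq> Q (snd (m u)) (snd (m v)))))"
  show False
  proof (rule labelled_wqo_no_antichain_by_reflection
      [OF _ wqo_on_Times[OF W wqo_on_finite_eq] A(2,3), of X P])
    \<comment> \<open>The coloured labels have a different type;
      \<open>labelled_wqo_universe\<close> moves the assumption there, which uses that
      \<open>'w\<close> is infinite.\<close>
    show "labelled_wqo TYPE('w \<times> 'c) X"
      using X inf labelled_wqo_universe by blast
  next
    fix a assume "a \<in> A"
    then obtain H l G where a: "a = (H, l)" "l ` verts H \<subseteq> W" "G \<in> X" "R G H"
      using A(1) by (auto simp: labellings_def graph_image_def)
    obtain c where c: "verts H = verts G" "\<forall>u v. u \<noteq> v \<longrightarrow>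
        ({u, v} \<in> edges H \<longleftrightarrow> ({u, v} \<in> edges G) \<noteq> Q (c u) (c v))"
      using R[OF a(4)] by blast
    have "(G, \<lambda>u. (l u, c u)) \<in> labellings X (W \<times> UNIV)"
      using a c by (auto simp: labellings_def)
    moreover have "P a (G, \<lambda>u. (l u, c u))"
      using c by (simp add: P_def a)
    ultimately show "\<exists>b\<in>labellings X (W \<times> UNIV). P a b"
      by blast
  next
    fix a b a' b'
    assume A': "a \<in> A" "a' \<in> A" and "P a b" "P a' b'"
      and le: "labelled_induced_subgraph (rel_prod le (=)) b b'"
    obtain H l G m where ab: "a = (H, l)" "b = (G, m)"
      by (cases a, cases b)
    obtain H' l' G' m' where ab': "a' = (H', l')" "b' = (G', m')"
      by (cases a', cases b')
    have s: "simple_graph H" "simple_graph H'"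
      using A' A(1) by (auto simp: ab ab' labellings_def graph_image_def)
    have H: "verts H = verts G" "\<And>u. fst (m u) = l u"
      "\<And>u v. u \<noteq> v \<Longrightarrow> {u, v} \<in> edges H \<longleftrightarrow> ({u, v} \<in> edges G) \<noteq> Q (snd (m u)) (snd (m v))"
      using \<open>P a b\<close> by (auto simp: P_def ab)
    have H': "verts H' = verts G'" "\<And>u. fst (m' u) = l' u"
      "\<And>u v. u \<noteq> v \<Longrightarrow> {u, v} \<in> edges H' \<longleftrightarrow> ({u, v} \<in> edges G') \<noteq> Q (snd (m' u)) (snd (m' v))"
      using \<open>P a' b'\<close> by (auto simp: P_def ab')
    obtain f where f: "inj_on f (verts G)" "f ` verts G \<subseteq> verts G'"
        "\<And>u v. u \<in> verts G \<Longrightarrow> v \<in> verts G \<Longrightarrow> {u, v} \<in> edges G \<longleftrightarrow> {f u, f v} \<in> edges G'"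
        "\<And>v. v \<in> verts G \<Longrightarrow> rel_prod le (=) (m v) (m' (f v))"
      using le by (auto simp: ab ab' labelled_induced_subgraph_iff)
    show "labelled_induced_subgraph le a a'"
      unfolding ab ab' labelled_induced_subgraph_iff
    proof (intro exI[of _ f] conjI ballI)
      show "inj_on f (verts H)" "f ` verts H \<subseteq> verts H'"
        using f H H' by simp_all
    next
      fix u v assume uv: "u \<in> verts H" "v \<in> verts H"
      show "{u, v} \<in> edges H \<longleftrightarrow> {f u, f v} \<in> edges H'"
      \<comment> \<open>The flipping rule speaks of distinct vertices only; on the diagonal both
        sides fail because simple graphs have no loops.\<close>
      proof (cases "u = v")
        case True
        then show ?thesis
          using s by (simp add: simple_graph_no_loop)
      next
        case False
        then have "f u \<noteq> f v"
          using f(1) uv H(1) by (simp add: inj_on_eq_iff)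
        moreover have "snd (m u) = snd (m' (f u))" "snd (m v) = snd (m' (f v))"
          using f(4) uv H(1) by (simp_all add: rel_prod_sel)
        ultimately show ?thesis
          using False H H' f(3) uv by simp
      qed
    next
      fix v assume "v \<in> verts H"
      then show "le (l v) (l' (f v))"
        using f(4) H H' by (simp add: rel_prod_sel)
    qed
  qed
qed

text \<open>As the vertex set does not change either, the same sets undo a complementation. Both
  complementations are therefore their own converses, and one transfer result serves both
  directions.\<close>

lemma complement_edges_complement_edges: "complement_edges P (complement_edges P G) = G"
  by (cases G) (auto simp: complement_edges_def)

lemma simple_graph_complement_edges:
  assumes "simple_graph G" "\<And>e. e \<in> P \<Longrightarrow> e \<subseteq> verts G \<and> card e = 2"
  shows "simple_graph (complement_edges P G)"
  using assms by (auto simp: simple_graph_def complement_edges_def)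

lemma conversep_subgraph_complementation:
  "subgraph_complementation\<inverse>\<inverse> = (subgraph_complementation :: 'v sgraph \<Rightarrow> 'v sgraph \<Rightarrow> bool)"
proof -
  have "subgraph_complementation H G" if "subgraph_complementation G H" for G H :: "'v sgraph"
  proof -
    obtain S where "S \<subseteq> verts G"
      "H = complement_edges {{u, v} |u v. u \<in> S \<and> v \<in> S \<and> u \<noteq> v} G"
      using \<open>subgraph_complementation G H\<close> by (auto simp: subgraph_complementation_def)
    then show ?thesis
      unfolding subgraph_complementation_def
      by (intro exI[of _ S]) (simp add: complement_edges_complement_edges,
          simp add: complement_edges_def)
  qed
  then show ?thesis
    by blast
qed

lemma conversep_bipartite_complementation:
  "bipartite_complementation\<inverse>\<inverse> = (bipartite_complementation :: 'v sgraph \<Rightarrow> 'v sgraph \<Rightarrow> bool)"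
proof -
  have "bipartite_complementation H G" if "bipartite_complementation G H" for G H :: "'v sgraph"
  proof -
    obtain X Y where "X \<subseteq> verts G" "Y \<subseteq> verts G" "X \<inter> Y = {}"
      "H = complement_edges {{x, y} |x y. x \<in> X \<and> y \<in> Y} G"
      using \<open>bipartite_complementation G H\<close> by (auto simp: bipartite_complementation_def)
    then show ?thesis
      unfolding bipartite_complementation_def
      by (intro exI[of _ X] exI[of _ Y]) (simp add: complement_edges_complement_edges,
          simp add: complement_edges_def)
  qed
  then show ?thesis
    by blast
qed

lemma preserves_subgraph_complementation:
  assumes "infinite (UNIV :: 'w set)"
  shows "preserves_labelled_wqo TYPE('w) (subgraph_complementation :: 'v sgraph \<Rightarrow> _)"
proof -
  have "transfers_labelled_wqo TYPE('w) (subgraph_complementation :: 'v sgraph \<Rightarrow> _)"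
  \<comment> \<open>The colour of a vertex is its membership in \<open>S\<close>; a pair is flipped
    iff both ends are in \<open>S\<close>.\<close>
  proof (rule transfers_recolouring[OF assms, where Q = "(\<and>)"])
    fix G H :: "'v sgraph"
    assume "subgraph_complementation G H"
    then obtain S where S: "H = complement_edges {{u, v} |u v. u \<in> S \<and> v \<in> S \<and> u \<noteq> v} G"
      by (auto simp: subgraph_complementation_def)
    have "{u, v} \<in> edges H \<longleftrightarrow> ({u, v} \<in> edges G) \<noteq> (u \<in> S \<and> v \<in> S)" if "u \<noteq> v" for u v
      using that by (auto simp: S complement_edges_def doubleton_eq_iff)
    then show "verts H = verts G \<and> (\<exists>c. \<forall>u v. u \<noteq> v \<longrightarrow>
        ({u, v} \<in> edges H) = (({u, v} \<in> edges G) \<noteq> (c u \<and> c v)))"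
      by (intro conjI exI[of _ "\<lambda>u. u \<in> S"]) (simp_all add: S complement_edges_def)
  qed
  moreover have "simple_graph H" if "simple_graph G" "subgraph_complementation G H"
    for G H :: "'v sgraph"
    using that by (auto simp: subgraph_complementation_def intro!: simple_graph_complement_edges)
  ultimately show ?thesis
    by (intro preserves_labelled_wqoI) (simp_all add: conversep_subgraph_complementation)
qed

lemma preserves_bipartite_complementation:
  assumes "infinite (UNIV :: 'w set)"
  shows "preserves_labelled_wqo TYPE('w) (bipartite_complementation :: 'v sgraph \<Rightarrow> _)"
proof -
  \<comment> \<open>The colour records membership in \<open>X\<close> and in \<open>Y\<close>. The
    rule is symmetric since either end of an unordered pair may be the one in
    \<open>X\<close>.\<close>
  let ?Q = "\<lambda>c d. fst c \<and> snd d \<or> snd c \<and> fst d"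
  have "transfers_labelled_wqo TYPE('w) (bipartite_complementation :: 'v sgraph \<Rightarrow> _)"
  proof (rule transfers_recolouring[OF assms, where Q = ?Q])
    fix G H :: "'v sgraph"
    assume "bipartite_complementation G H"
    then obtain X Y where S: "H = complement_edges {{x, y} |x y. x \<in> X \<and> y \<in> Y} G"
      by (auto simp: bipartite_complementation_def)
    have "{u, v} \<in> edges H \<longleftrightarrow>
      ({u, v} \<in> edges G) \<noteq> (u \<in> X \<and> v \<in> Y \<or> u \<in> Y \<and> v \<in> X)" for u v
      by (auto simp: S complement_edges_def doubleton_eq_iff)
    then show "verts H = verts G \<and> (\<exists>c. \<forall>u v. u \<noteq> v \<longrightarrow>
        ({u, v} \<in> edges H) = (({u, v} \<in> edges G) \<noteq> ?Q (c u) (c v)))"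
      by (intro conjI exI[of _ "\<lambda>u. (u \<in> X, u \<in> Y)"]) (simp_all add: S complement_edges_def)
  qed
  moreover have "simple_graph H" if G: "simple_graph G" and GH: "bipartite_complementation G H"
    for G H :: "'v sgraph"
  proof -
    obtain X Y where XY: "X \<subseteq> verts G" "Y \<subseteq> verts G" "X \<inter> Y = {}"
      "H = complement_edges {{x, y} |x y. x \<in> X \<and> y \<in> Y} G"
      using GH by (auto simp: bipartite_complementation_def)
    \<comment> \<open>Disjointness of \<open>X\<close> and \<open>Y\<close> is what keeps loops out
      of the complemented pairs.\<close>
    have "e \<subseteq> verts G \<and> card e = 2" if e: "e \<in> {{x, y} |x y. x \<in> X \<and> y \<in> Y}" for e
    proof -
      obtain x y where "e = {x, y}" "x \<in> X" "y \<in> Y"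
        using e by blast
      moreover from this have "x \<noteq> y"
        using XY(3) by blast
      ultimately show ?thesis
        using XY by auto
    qed
    then show ?thesis
      unfolding XY(4) by (rule simple_graph_complement_edges[OF G])
  qed
  ultimately show ?thesis
    by (intro preserves_labelled_wqoI) (simp_all add: conversep_bipartite_complementation)
qed

section \<open>Vertex deletion\<close>

text \<open>The graph before the deletion is the code, with the vertex to be deleted labelled
  \<open>None\<close> and all others keeping their labels under \<open>Some\<close>. An embedding of
  codes can then be restricted to the remaining vertices.\<close>

lemma transfers_vertex_deletion:
  assumes inf: "infinite (UNIV :: 'w set)"
  shows "transfers_labelled_wqo TYPE('w) (vertex_deletion :: 'v sgraph \<Rightarrow> _)"
proof (intro transfers_labelled_wqoI, unfold labelled_wqo_def[of "graph_image _ _"], intro allI impI notI)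
  fix X :: "'v sgraph set" and W :: "'w set" and le
  assume X: "graph_class X \<and> labelled_wqo TYPE('w) X" and W: "wqo_on W le"
    and "\<exists>A \<subseteq> labellings (graph_image vertex_deletion X) W.
      infinite A \<and> antichain (labelled_induced_subgraph le) A"
  then obtain A where A: "A \<subseteq> labellings (graph_image vertex_deletion X) W" "infinite A"
    "antichain (labelled_induced_subgraph le) A"
    by blast
  define P :: "('v, 'w) lgraph \<Rightarrow> ('v, 'w option) lgraph \<Rightarrow> bool" where
    "P = (\<lambda>(H, l) (G, m). \<exists>v\<in>verts G.
      H = \<lparr>verts = verts G - {v}, edges = {e \<in> edges G. v \<notin> e}\<rparr> \<and>
      m = (\<lambda>u. if u = v then None else Some (l u)))"
  show False
  proof (rule labelled_wqo_no_antichain_by_reflection[OF _ wqo_on_option[OF W] A(2,3), of X P])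
    show "labelled_wqo TYPE('w option) X"
      using X inf labelled_wqo_universe by blast
  next
    fix a assume "a \<in> A"
    then obtain H l G where a: "a = (H, l)" "l ` verts H \<subseteq> W" "G \<in> X" "vertex_deletion G H"
      using A(1) by (auto simp: labellings_def graph_image_def)
    then obtain v where v: "v \<in> verts G"
      "H = \<lparr>verts = verts G - {v}, edges = {e \<in> edges G. v \<notin> e}\<rparr>"
      by (auto simp: vertex_deletion_def)
    let ?m = "\<lambda>u. if u = v then None else Some (l u)"
    have "(G, ?m) \<in> labellings X (insert None (Some ` W))"
      using a v by (auto simp: labellings_def)
    moreover have "P a (G, ?m)"
      using v by (auto simp: P_def a)
    ultimately show "\<exists>b\<in>labellings X (insert None (Some ` W)). P a b"
      by blast
  next
    fix a b a' b'
    assume "P a b" "P a' b'" and le: "labelled_induced_subgraph (rel_option le) b b'"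
    obtain H l G m where ab: "a = (H, l)" "b = (G, m)"
      by (cases a, cases b)
    obtain H' l' G' m' where ab': "a' = (H', l')" "b' = (G', m')"
      by (cases a', cases b')
    obtain v where v: "v \<in> verts G"
      "H = \<lparr>verts = verts G - {v}, edges = {e \<in> edges G. v \<notin> e}\<rparr>"
      "m = (\<lambda>u. if u = v then None else Some (l u))"
      using \<open>P a b\<close> by (auto simp: P_def ab)
    obtain v' where v': "v' \<in> verts G'"
      "H' = \<lparr>verts = verts G' - {v'}, edges = {e \<in> edges G'. v' \<notin> e}\<rparr>"
      "m' = (\<lambda>u. if u = v' then None else Some (l' u))"
      using \<open>P a' b'\<close> by (auto simp: P_def ab')
    obtain f where f: "inj_on f (verts G)" "f ` verts G \<subseteq> verts G'"
        "\<And>u v. u \<in> verts G \<Longrightarrow> v \<in> verts G \<Longrightarrow> {u, v} \<in> edges G \<longleftrightarrow> {f u, f v} \<in> edges G'"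
        "\<And>v. v \<in> verts G \<Longrightarrow> rel_option le (m v) (m' (f v))"
      using le by (auto simp: ab ab' labelled_induced_subgraph_iff)
    \<comment> \<open>A remaining vertex has a \<open>Some\<close> label and so cannot be sent to
      \<open>v'\<close>, whose label is \<open>None\<close>.\<close>
    have fv: "f u \<noteq> v'" "le (l u) (l' (f u))" if "u \<in> verts H" for u
      using f(4)[of u] that by (auto simp: v v' split: if_splits)
    show "labelled_induced_subgraph le a a'"
      unfolding ab ab' labelled_induced_subgraph_iff
    proof (intro exI[of _ f] conjI ballI)
      show "inj_on f (verts H)"
        using f(1) by (rule inj_on_subset) (auto simp: v)
      show "f ` verts H \<subseteq> verts H'"
        using f(2) fv(1) by (auto simp: v(2) v'(2))
      show "{u, w} \<in> edges H \<longleftrightarrow> {f u, f w} \<in> edges H'" if "u \<in> verts H" "w \<in> verts H" for u w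
        using f(3)[of u w] that fv(1)[of u] fv(1)[of w] by (auto simp: v(2) v'(2))
      show "le (l u) (l' (f u))" if "u \<in> verts H" for u
        using fv(2) that .
    qed
  qed
qed

text \<open>Settles the graphs whose only vertex gets deleted. They have no edges, so comparing two
  of them amounts to comparing two labels.\<close>

lemma labelled_wqo_single_vertex:
  "labelled_wqo TYPE('w) {G :: 'v sgraph. simple_graph G \<and> (\<exists>v. verts G = {v})}"
  (is "labelled_wqo _ ?X")
  unfolding labelled_wqo_def
proof (intro allI impI notI)
  fix W :: "'w set" and le
  assume W: "wqo_on W le"
    and "\<exists>A \<subseteq> labellings ?X W. infinite A \<and> antichain (labelled_induced_subgraph le) A"
  then obtain A where A: "A \<subseteq> labellings ?X W" "infinite A"
    "antichain (labelled_induced_subgraph le) A"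
    by (elim exE conjE)
  obtain x :: "nat \<Rightarrow> ('v, 'w) lgraph" where x: "inj x" "range x \<subseteq> A"
    using infinite_countable_subset[OF A(2)] by blast
  define v where "v i = the_elem (verts (fst (x i)))" for i
  have "verts (fst (x i)) = {v i} \<and> snd (x i) (v i) \<in> W \<and> simple_graph (fst (x i))" for i
  proof -
    have "x i \<in> labellings ?X W"
      using x(2) A(1) by blast
    then show ?thesis
      by (auto simp: labellings_def v_def)
  qed
  then have v: "verts (fst (x i)) = {v i}" "snd (x i) (v i) \<in> W" "simple_graph (fst (x i))" for i
    by simp_all
  obtain i j where ij: "i < j" "le (snd (x i) (v i)) (snd (x j) (v j))"
    by (rule wqo_on_good_pair[OF W, of "\<lambda>i. snd (x i) (v i)"]) (rule v(2))
  have "labelled_induced_subgraph le (fst (x i), snd (x i)) (fst (x j), snd (x j))"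
    unfolding labelled_induced_subgraph_iff
    by (intro exI[of _ "\<lambda>_. v j"]) (simp add: v ij simple_graph_no_loop)
  moreover have "x i \<noteq> x j" "x i \<in> A" "x j \<in> A"
    using x ij(1) by (auto dest: injD)
  ultimately show False
    using A(3) by (simp add: antichain_def)
qed

text \<open>The graph \<open>H\<close> after the deletion is the code: each vertex carries its own
  label, the label of the missing vertex \<open>v\<close>, and a bit telling whether it is adjacent
  to \<open>v\<close>. These data suffice to extend an embedding of codes by sending
  \<open>v\<close> to \<open>v'\<close>.\<close>

lemma transfers_vertex_deletion_conversep:
  assumes inf: "infinite (UNIV :: 'w set)"
  shows "transfers_labelled_wqo TYPE('w) (vertex_deletion\<inverse>\<inverse> :: 'v sgraph \<Rightarrow> _)"
proof (rule transfers_labelled_wqoI)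
  fix X :: "'v sgraph set"
  assume X: "graph_class X \<and> labelled_wqo TYPE('w) X"
  let ?S = "{G :: 'v sgraph. simple_graph G \<and> (\<exists>v. verts G = {v})}"
  let ?X' = "X \<inter> {H. verts H \<noteq> {}}"
  let ?Y = "graph_image vertex_deletion\<inverse>\<inverse> ?X'"
  \<comment> \<open>The label of the restored vertex is carried by all remaining ones, so there has to be one.\<close>
  have "labelled_wqo TYPE('w) ?Y"
    unfolding labelled_wqo_def
  proof (intro allI impI notI)
    fix W :: "'w set" and le
    assume W: "wqo_on W le"
      and "\<exists>A \<subseteq> labellings ?Y W. infinite A \<and> antichain (labelled_induced_subgraph le) A"
    then obtain A where A: "A \<subseteq> labellings ?Y W" "infinite A"
      "antichain (labelled_induced_subgraph le) A"
      by (elim exE conjE)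
    define P :: "('v, 'w) lgraph \<Rightarrow> ('v, ('w \<times> 'w) \<times> bool) lgraph \<Rightarrow> bool" where
      "P = (\<lambda>(G, l) (H, m). \<exists>v\<in>verts G. verts H \<noteq> {} \<and>
        H = \<lparr>verts = verts G - {v}, edges = {e \<in> edges G. v \<notin> e}\<rparr> \<and>
        m = (\<lambda>u. ((l u, l v), {u, v} \<in> edges G)))"
    let ?W = "(W \<times> W) \<times> (UNIV :: bool set)"
    show False
    proof (rule labelled_wqo_no_antichain_by_reflection
        [OF _ wqo_on_Times[OF wqo_on_Times[OF W W] wqo_on_finite_eq] A(2,3), of X P])
      show "labelled_wqo TYPE(('w \<times> 'w) \<times> bool) X"
        using X inf labelled_wqo_universe by blast
    next
      fix a assume "a \<in> A"
      then have "a \<in> labellings ?Y W"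
        using A(1) by blast
      then obtain G l H where a: "a = (G, l)" "l ` verts G \<subseteq> W" "H \<in> X" "verts H \<noteq> {}"
        "vertex_deletion G H"
        by (auto simp: labellings_def graph_image_def)
      then obtain v where v: "v \<in> verts G"
        "H = \<lparr>verts = verts G - {v}, edges = {e \<in> edges G. v \<notin> e}\<rparr>"
        by (auto simp: vertex_deletion_def)
      let ?m = "\<lambda>u. ((l u, l v), {u, v} \<in> edges G)"
      have "(H, ?m) \<in> labellings X ?W"
        using a v by (auto simp: labellings_def)
      moreover have "P a (H, ?m)"
        using v a(4) unfolding P_def a by blast
      ultimately show "\<exists>b\<in>labellings X ?W. P a b"
        by blast
    next
      fix a b a' b'
      assume A': "a \<in> A" "a' \<in> A" and "P a b" "P a' b'"
        and le: "labelled_induced_subgraph (rel_prod (rel_prod le le) (=)) b b'"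
      obtain G l H m where ab: "a = (G, l)" "b = (H, m)"
        by (cases a, cases b)
      obtain G' l' H' m' where ab': "a' = (G', l')" "b' = (H', m')"
        by (cases a', cases b')
      have s: "simple_graph G" "simple_graph G'"
        using A' A(1) by (auto simp: ab ab' labellings_def graph_image_def)
      obtain v where v: "v \<in> verts G" "verts H \<noteq> {}"
        "H = \<lparr>verts = verts G - {v}, edges = {e \<in> edges G. v \<notin> e}\<rparr>"
        "m = (\<lambda>u. ((l u, l v), {u, v} \<in> edges G))"
        using \<open>P a b\<close> unfolding P_def ab by blast
      obtain v' where v': "v' \<in> verts G'"
        "H' = \<lparr>verts = verts G' - {v'}, edges = {e \<in> edges G'. v' \<notin> e}\<rparr>"
        "m' = (\<lambda>u. ((l' u, l' v'), {u, v'} \<in> edges G'))"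
        using \<open>P a' b'\<close> unfolding P_def ab' by blast
      obtain f where f: "inj_on f (verts H)" "f ` verts H \<subseteq> verts H'"
        "\<And>u v. u \<in> verts H \<Longrightarrow> v \<in> verts H \<Longrightarrow> {u, v} \<in> edges H \<longleftrightarrow> {f u, f v} \<in> edges H'"
        "\<And>v. v \<in> verts H \<Longrightarrow> rel_prod (rel_prod le le) (=) (m v) (m' (f v))"
        using le by (auto simp: ab ab' labelled_induced_subgraph_iff)
      \<comment> \<open>The three components of the enriched label at \<open>u\<close>. The second
        does not depend on \<open>u\<close>, so any one vertex of \<open>H\<close> yields the
        comparison needed at \<open>v\<close>.\<close>
      have l: "le (l u) (l' (f u))" "le (l v) (l' v')" "{u, v} \<in> edges G \<longleftrightarrow> {f u, v'} \<in> edges G'"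
        if "u \<in> verts H" for u
        using f(4)[OF that] by (simp_all add: v(4) v'(3))
      have G: "verts G = insert v (verts H)" "v \<notin> verts H"
        using v by auto
      have fH: "f u \<noteq> v'" "f u \<in> verts G'" if "u \<in> verts H" for u
        using f(2) that by (auto simp: v'(2))
      \<comment> \<open>The extension stays injective because \<open>f\<close> maps into
        \<open>H'\<close>, which does not contain \<open>v'\<close>; the adjacency bits settle the
        pairs containing \<open>v\<close>.\<close>
      let ?f = "f(v := v')"
      have fu: "?f u = f u" if "u \<in> verts H" for u
        using G(2) that by auto
      have e: "{u, w} \<in> edges G \<longleftrightarrow> {f u, f w} \<in> edges G'" if "u \<in> verts H" "w \<in> verts H" for u w
        using f(3)[OF that] that fH(1)[of u] fH(1)[of w] by (auto simp: v(3) v'(2))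
      show "labelled_induced_subgraph le a a'"
        unfolding ab ab' labelled_induced_subgraph_iff
      proof (intro exI[of _ ?f] conjI ballI)
        have "inj_on ?f (verts H)"
          using f(1) fu by (simp cong: inj_on_cong)
        moreover have "?f v \<notin> ?f ` verts H"
          using fu fH(1) by auto
        ultimately show "inj_on ?f (verts G)"
          unfolding G(1) by (simp add: G(2))
        show "?f ` verts G \<subseteq> verts G'"
          using fH(2) fu v'(1) unfolding G(1) by auto
      next
        fix u w assume "u \<in> verts G" "w \<in> verts G"
        then consider "u = v" "w = v" | "u = v" "w \<in> verts H" | "u \<in> verts H" "w = v"
          | "u \<in> verts H" "w \<in> verts H"
          using G(1) by blast
        then show "{u, w} \<in> edges G \<longleftrightarrow> {?f u, ?f w} \<in> edges G'"
        proof cases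
          case 1
          then show ?thesis
            using s by (simp add: simple_graph_no_loop)
        next
          case 2
          then show ?thesis
            using l(3)[of w] fu[of w] by (simp add: insert_commute)
        next
          case 3
          then show ?thesis
            using l(3)[of u] fu[of u] by simp
        next
          case 4
          then show ?thesis
            using e fu by simp
        qed
      next
        fix u assume "u \<in> verts G"
        then show "le (l u) (l' (?f u))"
          using G l v(2) fu by (cases "u = v") auto
      qed
    qed
  qed
  \<comment> \<open>The two cases, nothing or something left after the deletion, are joined as a
    union indexed by \<open>bool\<close>.\<close>
  then have "labelled_wqo TYPE('w) (\<Union>i\<in>(UNIV :: bool set). if i then ?S else ?Y)"
    using labelled_wqo_single_vertex by (intro labelled_wqo_UN) auto
  moreover have "graph_image vertex_deletion\<inverse>\<inverse> X \<subseteq> (\<Union>i\<in>(UNIV :: bool set). if i then ?S else ?Y)"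
  proof
    fix G assume "G \<in> graph_image vertex_deletion\<inverse>\<inverse> X"
    then obtain H where H: "simple_graph G" "H \<in> X" "vertex_deletion G H"
      by (auto simp: graph_image_def)
    then obtain v where "v \<in> verts G" "verts H = verts G - {v}"
      by (auto simp: vertex_deletion_def)
    with H have "G \<in> ?S \<or> G \<in> ?Y"
      by (cases "verts H = {}") (auto simp: graph_image_def)
    then show "G \<in> (\<Union>i\<in>(UNIV :: bool set). if i then ?S else ?Y)"
      by (auto simp: UNIV_bool)
  qed
  ultimately show "labelled_wqo TYPE('w) (graph_image vertex_deletion\<inverse>\<inverse> X)"
    by (rule labelled_wqo_subset)
qed

theorem lemma5:
  assumes "infinite (UNIV :: 'w set)"
  shows "preserves_labelled_wqo TYPE('w) (subgraph_complementation :: 'v sgraph \<Rightarrow> 'v sgraph \<Rightarrow> bool)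
       \<and> preserves_labelled_wqo TYPE('w) (bipartite_complementation :: 'v sgraph \<Rightarrow> 'v sgraph \<Rightarrow> bool)
       \<and> preserves_labelled_wqo TYPE('w) (vertex_deletion :: 'v sgraph \<Rightarrow> 'v sgraph \<Rightarrow> bool)"
proof (intro conjI)
  have "simple_graph H" if "simple_graph G" "vertex_deletion G H" for G H :: "'v sgraph"
    using that by (fastforce simp: simple_graph_def vertex_deletion_def)
  then show "preserves_labelled_wqo TYPE('w) (vertex_deletion :: 'v sgraph \<Rightarrow> 'v sgraph \<Rightarrow> bool)"
    by (intro preserves_labelled_wqoI transfers_vertex_deletion
        transfers_vertex_deletion_conversep assms)
qed (intro preserves_subgraph_complementation preserves_bipartite_complementation assms)+

end
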